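(* Let $A$ be an asymmetric fuzzy number such that $[A]_1=\{a_m\}$, let $a<b$ be real numbers, and let $f,g:[a,b]\to\mathbb{R}_{\mathcal{F}(A)}$ be two functions, $f(t)=r_f(t)+q_f(t)A$ and $g(t)=r_g(t)+q_g(t)A$. The following hold: (i) If $f,g$ are integrable and $$\int_a^b\left[f(t)\odot\eta(t)\oplus g(t)\odot\eta'(t)\right]dt=0$$ for every $\eta\in C^1([a,b],\mathbb{R}_{\mathcal{F}(A)})$ with $\eta(a)=\eta(b)=0$, then there exists a continuous function $\tilde g:[a,b]\to\mathbb{R}_{\mathcal{F}(A)}$ such that $\tilde g(t)\ominus g(t)\in\mathbb{R}_{\mathcal{F}(A)}^0$ and $\tilde g'(t)=f(t)$ for almost every $t\in[a,b]$. (ii) If $f,g$ are continuous, $g$ is differentiable almost everywhere, and $$\int_a^b\left[f(t)\odot\eta(t)\oplus g(t)\odot\eta'(t)\right]dt=0$$ for every $\eta\in C^1([a,b],\mathbb{R}_{\mathcal{F}(A)})$ with $\eta(a)=\eta(b)=0$, then $g'(t)=f(t)$ for almost every $t\in[a,b]$.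
   Context: A fuzzy subset of $\mathbb{R}$ is a function $A:\mathbb{R}\to[0,1]$; its $\alpha$-levels are $[A]_\alpha=\{x: A(x)\geq\alpha\}$ for $0<\alpha\leq1$ and $[A]_0=\overline{\{x:A(x)>0\}}$. $A$ is a fuzzy number if all its $\alpha$-levels are nonempty closed intervals and $\{x:A(x)>0\}$ is bounded. For $r,q\in\mathbb{R}$, $r+qA$ is the fuzzy number with $[r+qA]_\alpha=\{r+qx: x\in[A]_\alpha\}$ for every $\alpha\in[0,1]$; $r+0A$ is identified with the real number $r$. $A$ is asymmetric if for every $x\in\mathbb{R}$ there exists $y\in\mathbb{R}$ with $A(x-y)\neq A(x+y)$. Put $\mathbb{R}_{\mathcal{F}(A)}=\{r+qA: r,q\in\mathbb{R}\}$. When $A$ is asymmetric, $(r,q)\mapsto r+qA$ is a bijection from $\mathbb{R}^2$ onto $\mathbb{R}_{\mathcal{F}(A)}$, and $\mathbb{R}_{\mathcal{F}(A)}$ is a 2-dimensional real vector space with $(r_B+q_BA)\oplus(r_C+q_CA)=(r_B+r_C)+(q_B+q_C)A$, $\lambda(r+qA)=\lambda r+(\lambda q)A$ and $B\ominus C=B\oplus(-1)C$, normed by $\|r+qA\|=|q|+|r+qa_m|$. $\Psi$-cross product (for $[A]_1=\{a_m\}$): for $B=r_B+q_BA$, $C=r_C+q_CA$ with $[B]_1=\{b\}$, $[C]_1=\{c\}$, $B\odot C=cB+bC-bc$ (sum in the vector space $\mathbb{R}_{\mathcal{F}(A)}$ with addition $\oplus$, i.e. $B\odot C=cB\oplus bC\oplus(-bc)$),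 equivalently $B\odot C=(r_Br_C-a_m^2q_Bq_C)+(r_Bq_C+r_Cq_B+2a_mq_Bq_C)A$. The product $\odot$ binds tighter than $\oplus$. Also $B^2=B\odot B$ and $\mathbb{R}_{\mathcal{F}(A)}^0=\{B: B^2=0\}=\{r+qA: r+qa_m=0\}$. Integrability is Riemann integrability in the Banach space $\mathbb{R}_{\mathcal{F}(A)}$; $f=r(\cdot)+q(\cdot)A$ is integrable iff $r,q$ are Riemann integrable, and then $\int_a^b f=\int_a^b r+\left(\int_a^b q\right)A$. Continuity and derivatives are taken in the normed space and are equivalent to their componentwise versions: $f'=r'+q'A$. $C^1([a,b],\mathbb{R}_{\mathcal{F}(A)})$ is the set of continuously differentiable functions on $[a,b]$ (one-sided derivatives at endpoints). "Almost every(where)" refers to Lebesgue measure. *)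

theory Defs
  imports "HOL-Analysis.Analysis"
begin

definition level :: "(real \<Rightarrow> real) \<Rightarrow> real \<Rightarrow> real set" where
  "level A \<alpha> = (if \<alpha> = 0 then closure {x. A x > 0} else {x. A x \<ge> \<alpha>})"

definition fuzzy_number :: "(real \<Rightarrow> real) \<Rightarrow> bool" where
  "fuzzy_number A \<longleftrightarrow>
     (\<forall>x. A x \<in> {0..1}) \<and>
     (\<forall>\<alpha>\<in>{0..1}. level A \<alpha> \<noteq> {} \<and> closed (level A \<alpha>) \<and> is_interval (level A \<alpha>)) \<and>
     bounded {x. A x > 0}"

definition asymmetric :: "(real \<Rightarrow> real) \<Rightarrow> bool" where
  "asymmetric A \<longleftrightarrow> (\<forall>x. \<exists>y. A (x - y) \<noteq> A (x + y))"

text \<open>\<open>affine_fuzzy A r q\<close> is the fuzzy number \<open>r + qA\<close>; see \<open>affine_fuzzy_eq\<close> below for a closed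
  form. For \<open>q = 0\<close> it is the indicator function of \<open>{r}\<close>, which plays the role of the real number \<open>r\<close>.\<close>

definition affine_fuzzy :: "(real \<Rightarrow> real) \<Rightarrow> real \<Rightarrow> real \<Rightarrow> (real \<Rightarrow> real)" where
  "affine_fuzzy A r q =
     (THE B. fuzzy_number B \<and> (\<forall>\<alpha>\<in>{0..1}. level B \<alpha> = (\<lambda>x. r + q * x) ` level A \<alpha>))"

definition RF :: "(real \<Rightarrow> real) \<Rightarrow> (real \<Rightarrow> real) set" where
  "RF A = {affine_fuzzy A r q |r q. True}"

text \<open>The coordinates of an element of \<open>RF A\<close>. They, and everything built on them, are meaningful
  only for asymmetric \<open>A\<close> (see \<open>affine_fuzzy_inj\<close>) and for arguments in \<open>RF A\<close>.\<close>

definition coords :: "(real \<Rightarrow> real) \<Rightarrow> (real \<Rightarrow> real) \<Rightarrow> real \<times> real" where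
  "coords A B = (THE p. B = affine_fuzzy A (fst p) (snd p))"

definition rco :: "(real \<Rightarrow> real) \<Rightarrow> (real \<Rightarrow> real) \<Rightarrow> real" where
  "rco A B = fst (coords A B)"

definition qco :: "(real \<Rightarrow> real) \<Rightarrow> (real \<Rightarrow> real) \<Rightarrow> real" where
  "qco A B = snd (coords A B)"

definition fzero :: "(real \<Rightarrow> real) \<Rightarrow> (real \<Rightarrow> real)" where
  "fzero A = affine_fuzzy A 0 0"

definition fadd :: "(real \<Rightarrow> real) \<Rightarrow> (real \<Rightarrow> real) \<Rightarrow> (real \<Rightarrow> real) \<Rightarrow> (real \<Rightarrow> real)"
    ("(_ \<oplus>\<index> _)" [65, 66] 65) where
  "B \<oplus>\<^bsub>A\<^esub> C = affine_fuzzy A (rco A B + rco A C) (qco A B + qco A C)"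

definition fscale :: "(real \<Rightarrow> real) \<Rightarrow> real \<Rightarrow> (real \<Rightarrow> real) \<Rightarrow> (real \<Rightarrow> real)" where
  "fscale A c B = affine_fuzzy A (c * rco A B) (c * qco A B)"

definition fdiff :: "(real \<Rightarrow> real) \<Rightarrow> (real \<Rightarrow> real) \<Rightarrow> (real \<Rightarrow> real) \<Rightarrow> (real \<Rightarrow> real)"
    ("(_ \<ominus>\<index> _)" [65, 66] 65) where
  "B \<ominus>\<^bsub>A\<^esub> C = B \<oplus>\<^bsub>A\<^esub> fscale A (-1) C"

text \<open>\<open>core B\<close> is the \<open>b\<close> with \<open>[B]\<^sub>1 = {b}\<close>.\<close>

definition core :: "(real \<Rightarrow> real) \<Rightarrow> real" where
  "core B = (THE b. level B 1 = {b})"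

definition cross :: "(real \<Rightarrow> real) \<Rightarrow> (real \<Rightarrow> real) \<Rightarrow> (real \<Rightarrow> real) \<Rightarrow> (real \<Rightarrow> real)"
    ("(_ \<odot>\<index> _)" [70, 71] 70) where
  "B \<odot>\<^bsub>A\<^esub> C = fscale A (core C) B \<oplus>\<^bsub>A\<^esub> fscale A (core B) C \<oplus>\<^bsub>A\<^esub> affine_fuzzy A (- (core B * core C)) 0"

definition RF0 :: "(real \<Rightarrow> real) \<Rightarrow> (real \<Rightarrow> real) set" where
  "RF0 A = {B \<in> RF A. B \<odot>\<^bsub>A\<^esub> B = fzero A}"

definition fnorm :: "(real \<Rightarrow> real) \<Rightarrow> (real \<Rightarrow> real) \<Rightarrow> real" where
  "fnorm A B = \<bar>qco A B\<bar> + \<bar>rco A B + qco A B * core A\<bar>"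

definition fcontinuous_on :: "(real \<Rightarrow> real) \<Rightarrow> real set \<Rightarrow> (real \<Rightarrow> real \<Rightarrow> real) \<Rightarrow> bool" where
  "fcontinuous_on A S f \<longleftrightarrow>
     (\<forall>t\<in>S. ((\<lambda>s. fnorm A (f s \<ominus>\<^bsub>A\<^esub> f t)) \<longlongrightarrow> 0) (at t within S))"

definition has_fderiv ::
  "(real \<Rightarrow> real) \<Rightarrow> real set \<Rightarrow> (real \<Rightarrow> real \<Rightarrow> real) \<Rightarrow> real \<Rightarrow> (real \<Rightarrow> real) \<Rightarrow> bool" where
  "has_fderiv A S f t D \<longleftrightarrow> D \<in> RF A \<and>
     ((\<lambda>s. fnorm A (fscale A (1 / (s - t)) (f s \<ominus>\<^bsub>A\<^esub> f t) \<ominus>\<^bsub>A\<^esub> D)) \<longlongrightarrow> 0) (at t within S)"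

definition fdifferentiable ::
  "(real \<Rightarrow> real) \<Rightarrow> real set \<Rightarrow> (real \<Rightarrow> real \<Rightarrow> real) \<Rightarrow> real \<Rightarrow> bool" where
  "fdifferentiable A S f t \<longleftrightarrow> (\<exists>D. has_fderiv A S f t D)"

text \<open>\<open>fC1 A a b \<eta> \<eta>'\<close>: \<open>\<eta>\<close> belongs to \<open>C\<^sup>1([a,b], RF A)\<close> and has derivative \<open>\<eta>'\<close> on \<open>[a,b]\<close>
  (one-sided at the endpoints).\<close>

definition fC1 ::
  "(real \<Rightarrow> real) \<Rightarrow> real \<Rightarrow> real \<Rightarrow> (real \<Rightarrow> real \<Rightarrow> real) \<Rightarrow> (real \<Rightarrow> real \<Rightarrow> real) \<Rightarrow> bool" where
  "fC1 A a b \<eta> \<eta>' \<longleftrightarrow> \<eta> \<in> {a..b} \<rightarrow> RF A \<and>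
     (\<forall>t\<in>{a..b}. has_fderiv A {a..b} \<eta> t (\<eta>' t)) \<and> fcontinuous_on A {a..b} \<eta>'"

text \<open>The sum, with respect to \<open>\<oplus>\<close>, of a finite family; see \<open>fsum_empty\<close> and \<open>fsum_insert\<close>.\<close>

definition fsum :: "(real \<Rightarrow> real) \<Rightarrow> ('i \<Rightarrow> real \<Rightarrow> real) \<Rightarrow> 'i set \<Rightarrow> (real \<Rightarrow> real)" where
  "fsum A h I = affine_fuzzy A (\<Sum>i\<in>I. rco A (h i)) (\<Sum>i\<in>I. qco A (h i))"

text \<open>Riemann (not Henstock-Kurzweil) integral: the fineness \<open>d\<close> of the tagged divisions does not
  depend on the tag.\<close>

definition has_fint ::
  "(real \<Rightarrow> real) \<Rightarrow> real \<Rightarrow> real \<Rightarrow> (real \<Rightarrow> real \<Rightarrow> real) \<Rightarrow> (real \<Rightarrow> real) \<Rightarrow> bool" where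
  "has_fint A a b f J \<longleftrightarrow> J \<in> RF A \<and>
     (\<forall>\<epsilon>>0. \<exists>d>0. \<forall>p. p tagged_division_of {a..b} \<and> (\<lambda>x. ball x d) fine p \<longrightarrow>
        fnorm A (fsum A (\<lambda>(x, K). fscale A (measure lborel K) (f x)) p \<ominus>\<^bsub>A\<^esub> J) < \<epsilon>)"

definition fintegrable :: "(real \<Rightarrow> real) \<Rightarrow> real \<Rightarrow> real \<Rightarrow> (real \<Rightarrow> real \<Rightarrow> real) \<Rightarrow> bool" where
  "fintegrable A a b f \<longleftrightarrow> (\<exists>J. has_fint A a b f J)"


lemma fuzzy_number_level_Icc:
  assumes "fuzzy_number A" "\<alpha> \<in> {0..1}"
  obtains l u where "l \<le> u" "level A \<alpha> = {l..u}"
proof -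
  have b: "bounded {x. A x > 0}" and ne: "level A \<alpha> \<noteq> {}"
    and cl: "closed (level A \<alpha>)" and iv: "is_interval (level A \<alpha>)"
    using assms by (auto simp: fuzzy_number_def)
  have "level A \<alpha> \<subseteq> closure {x. A x > 0}"
    using assms(2) closure_subset[of "{x. A x > 0}"] by (auto simp: level_def subset_iff)
  then have "bounded (level A \<alpha>)"
    using b bounded_closure bounded_subset by blast
  then have "compact (level A \<alpha>)" "connected (level A \<alpha>)"
    using cl iv by (auto simp: compact_eq_bounded_closed is_interval_connected_1)
  then obtain l u where "level A \<alpha> = {l..u}"
    using connected_compact_interval_1 by blast
  with ne show ?thesis by (intro that[of l u]) auto
qed

lemma closure_affine_image:
  fixes S :: "real set"
  shows "closure ((\<lambda>x. r + q * x) ` S) = (\<lambda>x. r + q * x) ` closure S"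
proof -
  have "(\<lambda>x. r + q * x) ` T = (+) r ` ((*\<^sub>R) q ` T)" for T :: "real set"
    by (auto simp: image_image)
  then show ?thesis
    by (simp only: closure_translation closure_scaleR)
qed

lemma fuzzy_number_eqI:
  assumes "fuzzy_number B" "fuzzy_number C" "\<And>\<alpha>. \<alpha> \<in> {0..1} \<Longrightarrow> level B \<alpha> = level C \<alpha>"
  shows "B = C"
proof -
  have le: "B x \<le> C x" if "fuzzy_number B" "fuzzy_number C"
      "\<And>\<alpha>. \<alpha> \<in> {0..1} \<Longrightarrow> level B \<alpha> = level C \<alpha>" for B C :: "real \<Rightarrow> real" and x
  proof (cases "B x = 0")
    case True
    then show ?thesis using that(2) by (simp add: fuzzy_number_def)
  next
    case False
    have "B x \<in> {0..1}" using that(1) by (simp add: fuzzy_number_def)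
    moreover have "x \<in> level B (B x)" using False by (simp add: level_def)
    ultimately have "x \<in> level C (B x)" using that(3) by blast
    then show ?thesis using False by (simp add: level_def)
  qed
  show ?thesis
    using le[of B C] le[of C B] assms by (intro ext antisym) auto
qed

lemma fuzzy_numberI_levels:
  assumes A: "fuzzy_number A"
    and rng: "\<And>x. B x \<in> {0..1}"
    and lev: "\<And>\<alpha>. \<alpha> \<in> {0..1} \<Longrightarrow> level B \<alpha> = (\<lambda>x. r + q * x) ` level A \<alpha>"
  shows "fuzzy_number B"
proof -
  have cc: "\<exists>l u. l \<le> u \<and> level B \<alpha> = {l..u}" if \<alpha>: "\<alpha> \<in> {0..1}" for \<alpha>
  proof -
    obtain l u where lu: "l \<le> u" "level A \<alpha> = {l..u}"
      using fuzzy_number_level_Icc[OF A \<alpha>] by blast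
    have "(\<lambda>x. r + q * x) ` {l..u} = (\<lambda>x. q * x + r) ` {l..u}"
      by (simp add: add.commute)
    then have "level B \<alpha> = (if 0 \<le> q then {q * l + r..q * u + r} else {q * u + r..q * l + r})"
      using lu lev[OF \<alpha>] by (simp only: image_affinity_atLeastAtMost) auto
    moreover have "0 \<le> q \<Longrightarrow> q * l + r \<le> q * u + r" "\<not> 0 \<le> q \<Longrightarrow> q * u + r \<le> q * l + r"
      using lu(1) by (auto simp: mult_left_mono mult_left_mono_neg)
    ultimately show ?thesis by auto
  qed
  have "bounded (level B 0)" using cc[of 0] by auto
  then have "bounded {x. B x > 0}"
    using bounded_subset[OF _ closure_subset] by (simp add: level_def)
  moreover have "level B \<alpha> \<noteq> {} \<and> closed (level B \<alpha>) \<and> is_interval (level B \<alpha>)"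
    if "\<alpha> \<in> {0..1}" for \<alpha>
    using cc[OF that] by (auto simp: is_interval_cc)
  ultimately show ?thesis using rng by (auto simp: fuzzy_number_def)
qed

lemma affine_fuzzy_aux:
  assumes A: "fuzzy_number A"
  defines "C \<equiv> \<lambda>r q x. if q = 0 then (if x = r then 1 else 0) else A ((x - r) / q)"
  shows "fuzzy_number (C r q)"
    and "\<alpha> \<in> {0..1} \<Longrightarrow> level (C r q) \<alpha> = (\<lambda>x. r + q * x) ` level A \<alpha>"
    and "affine_fuzzy A r q = C r q"
proof -
  have rng: "C r q x \<in> {0..1}" for x
    using A by (auto simp: C_def fuzzy_number_def)
  have lev: "level (C r q) \<alpha> = (\<lambda>x. r + q * x) ` level A \<alpha>" if \<alpha>: "\<alpha> \<in> {0..1}" for \<alpha>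
  proof (cases "q = 0")
    case True
    have "level A \<alpha> \<noteq> {}" using A \<alpha> by (simp add: fuzzy_number_def)
    then have "(\<lambda>x. r + q * x) ` level A \<alpha> = {r}" using True by auto
    moreover have "{x. C r q x > 0} = {r}" "\<alpha> > 0 \<Longrightarrow> {x. C r q x \<ge> \<alpha>} = {r}"
      using True \<alpha> by (auto simp: C_def split: if_splits)
    ultimately show ?thesis using \<alpha> by (auto simp: level_def)
  next
    case False
    have im: "{x. P ((x - r) / q)} = (\<lambda>x. r + q * x) ` {x. P x}" for P
    proof (intro equalityI subsetI)
      fix x assume "x \<in> {x. P ((x - r) / q)}"
      then show "x \<in> (\<lambda>x. r + q * x) ` {x. P x}"
        using False by (intro image_eqI[of _ _ "(x - r) / q"]) auto
    qed (use False in auto)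
    show ?thesis
      using False im[of "\<lambda>y. A y > 0"] im[of "\<lambda>y. A y \<ge> \<alpha>"]
      by (simp add: level_def C_def closure_affine_image)
  qed
  show fn: "fuzzy_number (C r q)"
    using fuzzy_numberI_levels[OF A rng lev] .
  show "\<alpha> \<in> {0..1} \<Longrightarrow> level (C r q) \<alpha> = (\<lambda>x. r + q * x) ` level A \<alpha>"
    by (rule lev)
  show "affine_fuzzy A r q = C r q"
    unfolding affine_fuzzy_def
  proof (rule the_equality)
    show "fuzzy_number (C r q) \<and> (\<forall>\<alpha>\<in>{0..1}. level (C r q) \<alpha> = (\<lambda>x. r + q * x) ` level A \<alpha>)"
      using fn lev by blast
  next
    fix B
    assume "fuzzy_number B \<and> (\<forall>\<alpha>\<in>{0..1}. level B \<alpha> = (\<lambda>x. r + q * x) ` level A \<alpha>)"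
    then show "B = C r q" using fn lev by (intro fuzzy_number_eqI) auto
  qed
qed

lemma affine_fuzzy_eq:
  "fuzzy_number A \<Longrightarrow>
     affine_fuzzy A r q = (\<lambda>x. if q = 0 then (if x = r then 1 else 0) else A ((x - r) / q))"
  by (rule affine_fuzzy_aux(3))

lemma fuzzy_number_affine_fuzzy: "fuzzy_number A \<Longrightarrow> fuzzy_number (affine_fuzzy A r q)"
  using affine_fuzzy_aux(1,3) by simp

lemma level_affine_fuzzy:
  "fuzzy_number A \<Longrightarrow> \<alpha> \<in> {0..1} \<Longrightarrow>
     level (affine_fuzzy A r q) \<alpha> = (\<lambda>x. r + q * x) ` level A \<alpha>"
  using affine_fuzzy_aux(2,3) by simp

lemma affine_fuzzy_inj:
  assumes A: "fuzzy_number A" and asym: "asymmetric A" and a_m: "level A 1 = {a_m}"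
    and eq: "affine_fuzzy A r q = affine_fuzzy A r' q'"
  shows "r = r' \<and> q = q'"
proof -
  have c: "r + q * a_m = r' + q' * a_m"
    using arg_cong[OF eq, of "\<lambda>B. level B 1"] by (simp add: level_affine_fuzzy[OF A] a_m)
  obtain l u where lu: "l \<le> u" "level A 0 = {l..u}"
    using fuzzy_number_level_Icc[OF A, of 0] by auto
  have pos: "{x. A x > 0} \<subseteq> {l..u}"
    using lu(2) closure_subset[of "{x. A x > 0}"] by (simp add: level_def)
  have rng: "A x \<ge> 0" for x using A by (simp add: fuzzy_number_def)
  have "l < u"
  proof (rule ccontr)
    assume "\<not> l < u"
    with lu pos have z: "A x = 0" if "x \<noteq> l" for x
      using that rng[of x] by force
    obtain y where "A (l - y) \<noteq> A (l + y)" using asym by (auto simp: asymmetric_def)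
    then show False using z[of "l - y"] z[of "l + y"] by (cases "y = 0") auto
  qed
  have im: "(\<lambda>x. r + q * x) ` {l..u} = (\<lambda>x. r' + q' * x) ` {l..u}"
    using arg_cong[OF eq, of "\<lambda>B. level B 0"] by (simp add: level_affine_fuzzy[OF A] lu)
  have diam: "diameter ((\<lambda>x. r + q * x) ` {l..u}) = \<bar>q\<bar> * (u - l)" for r q
  proof -
    have "(\<lambda>x. r + q * x) ` {l..u} = (\<lambda>x. q * x + r) ` {l..u}" by (simp add: add.commute)
    also have "diameter \<dots> = \<bar>q\<bar> * (u - l)"
      using \<open>l < u\<close> mult_left_mono[of l u q] mult_left_mono_neg[of l u q]
      by (cases "q \<ge> 0")
        (simp_all add: image_affinity_atLeastAtMost diameter_closed_interval right_diff_distrib)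
    finally show ?thesis .
  qed
  have "\<bar>q\<bar> = \<bar>q'\<bar>"
    using im diam[of r q] diam[of r' q'] \<open>l < u\<close> by simp
  moreover have "q = q'" if "q = - q'"
  proof (rule ccontr)
    assume ne: "q \<noteq> q'"
    with that have q: "q \<noteq> 0" "q' \<noteq> 0" by auto
    obtain y where y: "A (a_m - y) \<noteq> A (a_m + y)" using asym by (auto simp: asymmetric_def)
    have r': "r' = r + 2 * q * a_m" using c that by simp
    have e1: "(r + q * (a_m + y) - r) / q = a_m + y" using q by simp
    have e2: "(r + q * (a_m + y) - r') / q' = a_m - y"
      using q that by (simp add: r' field_simps)
    have "A ((x - r) / q) = A ((x - r') / q')" for x
      using fun_cong[OF eq, of x] q by (simp add: affine_fuzzy_eq[OF A])
    from this[of "r + q * (a_m + y)"] show False using y by (simp only: e1 e2)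
  qed
  ultimately have "q = q'" by linarith
  then show ?thesis using c by simp
qed

context
  fixes A :: "real \<Rightarrow> real" and a_m :: real
  assumes A: "fuzzy_number A" "asymmetric A" "level A 1 = {a_m}"
begin

lemma coords_affine_fuzzy: "coords A (affine_fuzzy A r q) = (r, q)"
  unfolding coords_def
  by (rule the_equality) (auto dest: affine_fuzzy_inj[OF A])

lemma rco_affine_fuzzy [simp]: "rco A (affine_fuzzy A r q) = r"
  and qco_affine_fuzzy [simp]: "qco A (affine_fuzzy A r q) = q"
  by (simp_all add: rco_def qco_def coords_affine_fuzzy)

lemma core_affine_fuzzy: "core (affine_fuzzy A r q) = r + q * a_m"
  using A by (simp add: core_def level_affine_fuzzy)

lemma core_base: "core A = a_m"
  using A by (simp add: core_def)

lemma cross_affine_fuzzy: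
  "affine_fuzzy A r q \<odot>\<^bsub>A\<^esub> affine_fuzzy A r' q' =
     affine_fuzzy A (r * r' - a_m\<^sup>2 * q * q') (r * q' + r' * q + 2 * a_m * q * q')"
  by (simp add: cross_def fadd_def fscale_def core_affine_fuzzy power2_eq_square algebra_simps)

lemma affine_fuzzy_in_RF0_iff: "affine_fuzzy A r q \<in> RF0 A \<longleftrightarrow> r + q * a_m = 0"
proof
  assume "affine_fuzzy A r q \<in> RF0 A"
  then have "affine_fuzzy A (r * r - a_m\<^sup>2 * q * q) (r * q + r * q + 2 * a_m * q * q)
      = affine_fuzzy A 0 0"
    by (simp add: RF0_def fzero_def cross_affine_fuzzy)
  from affine_fuzzy_inj[OF A this]
  have "r * r - a_m\<^sup>2 * q * q = 0" "r * q + r * q + 2 * a_m * q * q = 0" by auto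
  then have "(r + q * a_m) * (r + q * a_m) = 0"
    by algebra
  then show "r + q * a_m = 0" by simp
next
  assume "r + q * a_m = 0"
  then have r: "r = - (q * a_m)" by simp
  have "affine_fuzzy A r q \<odot>\<^bsub>A\<^esub> affine_fuzzy A r q = fzero A"
    by (simp add: cross_affine_fuzzy fzero_def r power2_eq_square algebra_simps)
  then show "affine_fuzzy A r q \<in> RF0 A" by (auto simp: RF0_def RF_def)
qed

lemma fsum_empty: "fsum A h {} = fzero A"
  by (simp add: fsum_def fzero_def)

lemma fsum_insert: "finite I \<Longrightarrow> i \<notin> I \<Longrightarrow> fsum A h (insert i I) = h i \<oplus>\<^bsub>A\<^esub> fsum A h I"
  by (simp add: fsum_def fadd_def)

end

end

theory Submission
  imports Defs
begin

text \<open>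
  The vector space of all \<open>r + qA\<close> is two-dimensional, and convergence, derivatives and
  integrals in it are taken coordinatewise. The product \<open>B \<odot> (e + 0A) = eB\<close> with a real number
  \<open>e\<close> is multiplication by a scalar. Test functions \<open>\<eta> = e + 0A\<close> with real-valued \<open>e\<close> therefore
  already turn the hypothesis into two independent real statements,
  \<open>\<integral> (F e + G e') = 0\<close>, where \<open>(F, G)\<close> is \<open>(r\<^sub>f, r\<^sub>g)\<close> or \<open>(q\<^sub>f, q\<^sub>g)\<close>
  (\<open>fweak_derivative_components\<close>). What remains is the du Bois-Reymond lemma for real functions.

  For that, let \<open>\<Phi>\<close> be the primitive of \<open>F\<close>, let \<open>c\<close> be the mean of \<open>G - \<Phi>\<close> over \<open>[a, b]\<close>,
  and let \<open>W\<close> be the primitive of \<open>w = G - \<Phi> - c\<close>, so that \<open>W a = W b = 0\<close>. A single test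
  function suffices: the solution \<open>e\<close> of \<open>e'' = W\<close>, \<open>e a = e b = 0\<close>. Integrating by parts twice,
  \<open>0 = \<integral> (F e + G e') = \<integral> (G - \<Phi>) e' = \<integral> w e' = - \<integral> W\<^sup>2\<close>,
  hence \<open>W = 0\<close>, that is, \<open>G\<close> and \<open>c + \<Phi>\<close> have the same indefinite integral
  (\<open>du_Bois_Reymond_integrated\<close>).

  If \<open>F\<close> and \<open>G\<close> are integrable, Lebesgue's differentiation theorem gives \<open>G = c + \<Phi>\<close> and
  \<open>\<Phi>' = F\<close> almost everywhere. The two continuous functions \<open>c + \<Phi>\<close>, one for each coordinate,
  are the coordinates of the function \<open>h\<close> required in the first part: \<open>h\<close> equals \<open>g\<close> almost
  everywhere, and \<open>0\<close> lies in \<open>RF0 A\<close>. If \<open>F\<close> and \<open>G\<close> are continuous, both equations hold at every point, which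
  gives the second part.

  The integrations by parts involve a primitive of a function that need not be continuous, so the
  fundamental theorem of calculus does not apply to it. They use instead that a Riemann integrable
  function is bounded (\<open>has_riemann_integral_imp_bounded\<close>), which makes the defect in the
  formula over an interval quadratic in the length of that interval, and hence zero
  (\<open>integration_by_parts_bounded_integrable\<close>).
\<close>

section \<open>The Riemann integral of real functions\<close>

definition has_riemann_integral :: "(real \<Rightarrow> real) \<Rightarrow> real \<Rightarrow> real \<Rightarrow> real \<Rightarrow> bool" where
  "has_riemann_integral F J a b \<longleftrightarrow>
     (\<forall>\<epsilon>>0. \<exists>d>0. \<forall>p. p tagged_division_of {a..b} \<and> (\<lambda>x. ball x d) fine p \<longrightarrow>
        \<bar>(\<Sum>(x, K)\<in>p. measure lborel K * F x) - J\<bar> < \<epsilon>)"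

lemma has_riemann_integral_imp_has_integral:
  assumes "has_riemann_integral F J a b"
  shows "(F has_integral J) {a..b}"
  unfolding has_integral_real
proof (intro allI impI)
  fix \<epsilon> :: real assume "\<epsilon> > 0"
  then obtain d where "d > 0"
    and d: "\<forall>p. p tagged_division_of {a..b} \<and> (\<lambda>x. ball x d) fine p \<longrightarrow>
        \<bar>(\<Sum>(x, K)\<in>p. measure lborel K * F x) - J\<bar> < \<epsilon>"
    using assms unfolding has_riemann_integral_def by blast
  then show "\<exists>\<gamma>. gauge \<gamma> \<and> (\<forall>p. p tagged_division_of {a..b} \<and> \<gamma> fine p \<longrightarrow>
      norm ((\<Sum>(x, K)\<in>p. measure lborel K *\<^sub>R F x) - J) < \<epsilon>)"
    by (intro exI[of _ "\<lambda>x. ball x d"]) (auto simp: gauge_ball)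
qed

text \<open>The rest \<open>R\<close> of the division does not depend on the tag \<open>z\<close>: two Riemann sums can thus be
  made to differ in a single tag, which is moved freely within \<open>{l..u}\<close>.\<close>

lemma tagged_division_extend_Icc:
  fixes a b l u d :: real
  assumes "d > 0" "a \<le> l" "l < u" "u \<le> b" "u - l < d"
  shows "\<exists>R. finite R \<and> (\<forall>z\<in>{l..u}. insert (z, {l..u}) R tagged_division_of {a..b} \<and>
    (\<lambda>x. ball x d) fine insert (z, {l..u}) R \<and> (z, {l..u}) \<notin> R)"
proof -
  have g: "gauge (\<lambda>x::real. ball x d)" using \<open>d > 0\<close> by (simp add: gauge_ball)
  obtain p where p: "p tagged_division_of {a..l}" "(\<lambda>x. ball x d) fine p"
    using fine_division_exists_real[OF g] by blast
  obtain q where q: "q tagged_division_of {u..b}" "(\<lambda>x. ball x d) fine q"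
    using fine_division_exists_real[OF g] by blast
  show ?thesis
  proof (intro exI[of _ "p \<union> q"] conjI ballI)
    show "finite (p \<union> q)" using p(1) q(1) by blast
    fix z assume z: "z \<in> {l..u}"
    have "(p \<union> {(z, {l..u})}) tagged_division_of ({a..l} \<union> {l..u})"
      using p(1) z by (intro tagged_division_Un tagged_division_of_self_real) auto
    moreover have "{a..l} \<union> {l..u} = {a..u}" using assms by auto
    ultimately have "(p \<union> {(z, {l..u})}) tagged_division_of {a..u}" by simp
    then have "((p \<union> {(z, {l..u})}) \<union> q) tagged_division_of ({a..u} \<union> {u..b})"
      using q(1) by (intro tagged_division_Un) auto
    moreover have "{a..u} \<union> {u..b} = {a..b}" using assms by auto
    moreover have "(p \<union> {(z, {l..u})}) \<union> q = insert (z, {l..u}) (p \<union> q)" by auto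
    ultimately have "insert (z, {l..u}) (p \<union> q) tagged_division_of {a..b}" by simp
    moreover have "{l..u} \<subseteq> ball z d"
      using z assms by (auto simp: dist_real_def)
    then have "(\<lambda>x. ball x d) fine insert (z, {l..u}) (p \<union> q)"
      using p(2) q(2) by (auto simp: fine_def)
    moreover have "\<not> {l..u} \<subseteq> {a..l}" "\<not> {l..u} \<subseteq> {u..b}"
      using assms by (auto simp: subset_iff intro: exI[of _ u] exI[of _ l])
    then have "(z, {l..u}) \<notin> p \<union> q"
      using tagged_division_ofD(3)[OF p(1)] tagged_division_ofD(3)[OF q(1)] by blast
    ultimately show "insert (z, {l..u}) (p \<union> q) tagged_division_of {a..b}"
      "(\<lambda>x. ball x d) fine insert (z, {l..u}) (p \<union> q)" "(z, {l..u}) \<notin> p \<union> q"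
      by blast+
  qed
qed

text \<open>Moving a single tag within an interval of length at least \<open>m\<close> changes a fine Riemann sum by at
  most \<open>2\<close>, hence the function by at most \<open>2 / m\<close>. Since \<open>m\<close> is the same everywhere on \<open>{a..b}\<close>,
  finitely many such intervals bound the function. This is where the fineness must not depend
  on the tag: a Henstock-Kurzweil integrable function can be unbounded.\<close>

lemma has_riemann_integral_imp_bounded:
  assumes F: "has_riemann_integral F J a b" and "a < b"
  shows "bounded (F ` {a..b})"
proof -
  obtain d where "d > 0"
    and d: "\<forall>p. p tagged_division_of {a..b} \<and> (\<lambda>x. ball x d) fine p \<longrightarrow>
        \<bar>(\<Sum>(x, K)\<in>p. measure lborel K * F x) - J\<bar> < 1"
    using F[unfolded has_riemann_integral_def, rule_format, OF zero_less_one] by blast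
  define m where "m = min (d / 3) (b - a)"
  have "m > 0" using \<open>d > 0\<close> \<open>a < b\<close> by (simp add: m_def)
  have osc: "\<bar>F x - F z\<bar> \<le> 2 / m" if z: "z \<in> {a..b}" and x: "x \<in> {a..b}" "x \<in> ball z (d / 3)" for x z
  proof -
    have zx: "z - d / 3 < x" "x < z + d / 3"
      using x(2) unfolding mem_ball dist_real_def by linarith+
    \<comment> \<open>Cutting off at the endpoints keeps the interval inside \<open>{a..b}\<close>; its length stays at least \<open>m\<close>.\<close>
    define l u where "l = max a (z - d / 3)" and "u = min b (z + d / 3)"
    have lu: "a \<le> l" "l < u" "u \<le> b" "u - l < d" "m \<le> u - l" "z \<in> {l..u}" "x \<in> {l..u}"
      using z x(1) zx \<open>d > 0\<close> \<open>a < b\<close> unfolding l_def u_def m_def atLeastAtMost_iff by linarith+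
    obtain R where R: "finite R"
      "\<forall>z\<in>{l..u}. insert (z, {l..u}) R tagged_division_of {a..b} \<and>
         (\<lambda>x. ball x d) fine insert (z, {l..u}) R \<and> (z, {l..u}) \<notin> R"
      using tagged_division_extend_Icc[OF \<open>d > 0\<close> lu(1-4)] by blast
    define S where "S = (\<Sum>(x, K)\<in>R. measure lborel K * F x)"
    have "\<bar>(u - l) * F y + S - J\<bar> < 1" if "y \<in> {l..u}" for y
    proof -
      have R': "insert (y, {l..u}) R tagged_division_of {a..b}"
        "(\<lambda>x. ball x d) fine insert (y, {l..u}) R" "(y, {l..u}) \<notin> R"
        using R(2) that by blast+
      then have "\<bar>(\<Sum>(x, K)\<in>insert (y, {l..u}) R. measure lborel K * F x) - J\<bar> < 1"
        using d by blast
      then show ?thesis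
        using R(1) R'(3) lu(2) by (simp add: S_def)
    qed
    from this[OF lu(6)] this[OF lu(7)] have "\<bar>(u - l) * F x - (u - l) * F z\<bar> < 2" by linarith
    then have "(u - l) * \<bar>F x - F z\<bar> < 2"
      using lu(2) by (simp add: abs_mult flip: right_diff_distrib)
    moreover have "m * \<bar>F x - F z\<bar> \<le> (u - l) * \<bar>F x - F z\<bar>"
      using lu(5) by (intro mult_right_mono) auto
    ultimately show ?thesis using \<open>m > 0\<close> by (simp add: field_simps)
  qed
  have "seq_compact {a..b}" by (rule compact_imp_seq_compact) simp
  then obtain Z where Z: "finite Z" "Z \<subseteq> {a..b}" "{a..b} \<subseteq> (\<Union>z\<in>Z. ball z (d / 3))"
    using seq_compact_imp_totally_bounded[rule_format, of "{a..b}" "d / 3"] \<open>d > 0\<close> by auto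
  have "F ` {a..b} \<subseteq> (\<Union>z\<in>Z. cball (F z) (2 / m))"
  proof
    fix y assume "y \<in> F ` {a..b}"
    then obtain x where x: "x \<in> {a..b}" "y = F x" by blast
    then obtain z where z: "z \<in> Z" "x \<in> ball z (d / 3)" using Z(3) by blast
    then have "\<bar>F x - F z\<bar> \<le> 2 / m" using osc[of z x] x(1) Z(2) by blast
    then have "y \<in> cball (F z) (2 / m)"
      by (simp add: x(2) dist_real_def abs_minus_commute)
    with z(1) show "y \<in> (\<Union>z\<in>Z. cball (F z) (2 / m))" by blast
  qed
  moreover have "bounded (\<Union>z\<in>Z. cball (F z) (2 / m))"
    using Z(1) by (intro bounded_UN) auto
  ultimately show ?thesis by (rule bounded_subset[rotated])
qed

lemma bounded_integrable_imp_absolutely_integrable: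
  fixes F :: "real \<Rightarrow> real"
  assumes "F integrable_on {a..b}" "bounded (F ` {a..b})"
  shows "F absolutely_integrable_on {a..b}"
proof -
  obtain M where "\<forall>x\<in>{a..b}. norm (F x) \<le> M"
    using assms(2) by (auto simp: bounded_iff)
  then show ?thesis
    using assms(1) by (intro absolutely_integrable_integrable_bound[where g = "\<lambda>_. M"]) auto
qed

text \<open>A product of Henstock-Kurzweil integrable functions need not be integrable. Boundedness makes
  \<open>F\<close> absolutely integrable, and this survives multiplication by a continuous function.\<close>

lemma bounded_integrable_mult_continuous:
  fixes F e :: "real \<Rightarrow> real"
  assumes "F integrable_on {a..b}" "bounded (F ` {a..b})" "continuous_on {a..b} e"
  shows "(\<lambda>t. F t * e t) integrable_on {a..b}"
proof -
  have "bounded (e ` {a..b})"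
    using assms(3) by (intro compact_imp_bounded compact_continuous_image) auto
  then have "(\<lambda>t. e t * F t) absolutely_integrable_on {a..b}"
    using assms by (intro absolutely_integrable_bounded_measurable_product_real
        continuous_imp_measurable_on_sets_lebesgue bounded_integrable_imp_absolutely_integrable) auto
  then show ?thesis
    using absolutely_integrable_on_def by (auto simp: mult.commute)
qed

section \<open>Integration by parts for primitives of bounded functions\<close>

lemma quadratic_increments_imp_constant:
  fixes D :: "real \<Rightarrow> real"
  assumes "\<And>x y. a \<le> x \<Longrightarrow> x \<le> y \<Longrightarrow> y \<le> b \<Longrightarrow> \<bar>D y - D x\<bar> \<le> C * (y - x)\<^sup>2" and "a \<le> b"
  shows "D b = D a"
proof -
  have C: "\<bar>D y - D x\<bar> \<le> C * (y - x)\<^sup>2" if "x \<in> {a..b}" "y \<in> {a..b}" for x y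
    using assms(1)[of x y] assms(1)[of y x] that
    by (cases "x \<le> y") (auto simp: abs_minus_commute power2_commute)
  have "(D has_real_derivative 0) (at x within {a..b})" if "x \<in> {a..b}" for x
    unfolding has_field_derivative_iff
  proof (rule Lim_null_comparison)
    have "norm ((D y - D x) / (y - x)) \<le> \<bar>C\<bar> * \<bar>y - x\<bar>" if y: "y \<in> {a..b}" "y \<noteq> x" for y
    proof -
      have "\<bar>D y - D x\<bar> \<le> \<bar>C\<bar> * (y - x)\<^sup>2"
        using C[OF \<open>x \<in> _\<close> y(1)] by (smt (verit) mult_right_mono zero_le_power2)
      also have "\<dots> = (\<bar>C\<bar> * \<bar>y - x\<bar>) * \<bar>y - x\<bar>"
        by (simp add: power2_eq_square abs_mult_self_eq mult.assoc)
      finally show ?thesis using y(2) by (simp add: pos_divide_le_eq)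
    qed
    then show "\<forall>\<^sub>F y in at x within {a..b}. norm ((D y - D x) / (y - x)) \<le> \<bar>C\<bar> * \<bar>y - x\<bar>"
      by (auto simp: eventually_at_filter)
    show "((\<lambda>y. \<bar>C\<bar> * \<bar>y - x\<bar>) \<longlongrightarrow> 0) (at x within {a..b})"
      by (auto intro!: tendsto_eq_intros)
  qed
  then have "(D has_derivative (\<lambda>_. 0)) (at x within {a..b})" if "x \<in> {a..b}" for x
    using that by (simp add: has_field_derivative_def lambda_zero)
  then show ?thesis
    using has_derivative_zero_constant[of "{a..b}" D] \<open>a \<le> b\<close> by fastforce
qed

text \<open>Let \<open>\<Phi>\<close> be the primitive of \<open>F\<close>. The defect \<open>D t = \<integral>\<^sub>a\<^sup>t (F e + \<Phi> e') - \<Phi> t * e t\<close> satisfies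
  \<open>D y - D x = \<integral>\<^sub>x\<^sup>y (F (e - e x) + (\<Phi> - \<Phi> x) e') - (\<Phi> y - \<Phi> x) (e y - e x)\<close>. Since \<open>\<Phi>\<close> and
  \<open>e\<close> are Lipschitz, each term is of order \<open>(y - x)\<^sup>2\<close>, so \<open>D\<close> is constant. No pointwise
  derivative of \<open>\<Phi>\<close> enters the argument.\<close>

lemma integration_by_parts_bounded_integrable:
  fixes F e e' :: "real \<Rightarrow> real"
  assumes F: "F integrable_on {a..b}" "bounded (F ` {a..b})" and "a \<le> b"
    and e: "\<And>t. t \<in> {a..b} \<Longrightarrow> (e has_real_derivative e' t) (at t within {a..b})"
    and e': "continuous_on {a..b} e'"
  shows "integral {a..b} (\<lambda>t. F t * e t)
    = integral {a..b} F * e b - integral {a..b} (\<lambda>t. integral {a..t} F * e' t)"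
proof -
  define \<Phi> where "\<Phi> t = integral {a..t} F" for t
  have ce: "continuous_on {a..b} e"
    using e DERIV_continuous_on by blast
  have c\<Phi>: "continuous_on {a..b} \<Phi>"
    unfolding \<Phi>_def using F(1) by (rule indefinite_integral_continuous_1)
  obtain M where M: "M > 0" "\<forall>x\<in>{a..b}. \<bar>F x\<bar> \<le> M"
    using F(2) by (auto simp: bounded_pos)
  have "bounded (e' ` {a..b})"
    using e' by (intro compact_imp_bounded compact_continuous_image) auto
  then obtain L where L: "L > 0" "\<forall>x\<in>{a..b}. \<bar>e' x\<bar> \<le> L"
    by (auto simp: bounded_pos)
  have iFe: "(\<lambda>t. F t * e t) integrable_on {a..b}"
    by (rule bounded_integrable_mult_continuous[OF F ce])
  have i\<Phi>e: "(\<lambda>t. \<Phi> t * e' t) integrable_on {a..b}"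
    using c\<Phi> e' by (intro integrable_continuous_real continuous_intros)
  define K where "K t = F t * e t + \<Phi> t * e' t" for t
  have iK: "K integrable_on {a..b}"
    unfolding K_def using iFe i\<Phi>e by (rule integrable_add)
  define D where "D t = integral {a..t} K - \<Phi> t * e t" for t
  have "\<bar>D y - D x\<bar> \<le> 3 * M * L * (y - x)\<^sup>2" if xy: "a \<le> x" "x \<le> y" "y \<le> b" for x y
  proof -
    have sub: "{x..y} \<subseteq> {a..b}" using xy by auto
    note isub = integrable_subinterval_real[OF _ sub]
    have \<Phi>s: "\<Phi> s - \<Phi> x = integral {x..s} F" if "s \<in> {x..y}" for s
      using Henstock_Kurzweil_Integration.integral_combine[of a x s F]
        integrable_subinterval_real[OF F(1), of a s] that xy
      by (auto simp: \<Phi>_def)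
    have \<Phi>b: "\<bar>\<Phi> s - \<Phi> x\<bar> \<le> M * (y - x)" if s: "s \<in> {x..y}" for s
    proof -
      have "\<bar>integral {x..s} F\<bar> \<le> M * (s - x)"
        using has_integral_bound_real[OF _ finite.emptyI
            integrable_integral[OF integrable_subinterval_real[OF F(1)]],
            where B = M and a = x and b = s]
          s sub M by auto
      also have "\<dots> \<le> M * (y - x)" using s M by (intro mult_left_mono) auto
      finally show ?thesis using \<Phi>s[OF s] by simp
    qed
    have eb: "\<bar>e s - e x\<bar> \<le> L * (y - x)" if s: "s \<in> {x..y}" for s
    proof -
      have "norm (e s - e x) \<le> L * norm (s - x)"
        using s sub L(2) by (intro field_differentiable_bound[of "{a..b}" e e']) (auto intro: e)
      also have "\<dots> \<le> L * (y - x)" using s L by (intro mult_left_mono) auto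
      finally show ?thesis by simp
    qed
    define H where "H s = F s * (e s - e x) + (\<Phi> s - \<Phi> x) * e' s" for s
    have ie': "(e' has_integral (e y - e x)) {x..y}"
      using DERIV_subset[OF e sub] sub xy by (intro fundamental_theorem_of_calculus)
        (auto simp flip: has_real_derivative_iff_has_vector_derivative)
    have "(H has_integral (integral {x..y} K - e x * (\<Phi> y - \<Phi> x) - \<Phi> x * (e y - e x))) {x..y}"
    proof -
      have "((\<lambda>s. K s - e x * F s - \<Phi> x * e' s) has_integral
          (integral {x..y} K - e x * (\<Phi> y - \<Phi> x) - \<Phi> x * (e y - e x))) {x..y}"
        using isub[OF iK] isub[OF F(1)] ie' \<Phi>s[of y] xy
        by (intro has_integral_diff has_integral_mult_right) (auto simp: integrable_integral)
      then show ?thesis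
        by (rule has_integral_eq[rotated]) (simp add: H_def K_def algebra_simps)
    qed
    moreover have "integral {x..y} K = integral {a..y} K - integral {a..x} K"
      using Henstock_Kurzweil_Integration.integral_combine[of a x y K] integrable_subinterval_real[OF iK, of a y] xy by auto
    ultimately have H: "(H has_integral (D y - D x + (\<Phi> y - \<Phi> x) * (e y - e x))) {x..y}"
      by (simp add: D_def algebra_simps)
    have "\<bar>D y - D x + (\<Phi> y - \<Phi> x) * (e y - e x)\<bar> \<le> (2 * M * L * (y - x)) * (y - x)"
    proof -
      have "norm (H s) \<le> 2 * M * L * (y - x)" if s: "s \<in> {x..y}" for s
      proof -
        have "\<bar>H s\<bar> \<le> \<bar>F s\<bar> * \<bar>e s - e x\<bar> + \<bar>\<Phi> s - \<Phi> x\<bar> * \<bar>e' s\<bar>"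
          unfolding H_def abs_mult[symmetric] by (rule abs_triangle_ineq)
        also have "\<dots> \<le> M * (L * (y - x)) + (M * (y - x)) * L"
          using s sub M L xy eb[OF s] \<Phi>b[OF s]
          by (intro add_mono mult_mono) auto
        finally show ?thesis by (simp add: algebra_simps)
      qed
      then show ?thesis
        using has_integral_bound_real[OF _ finite.emptyI H, where B = "2 * M * L * (y - x)"] M L xy by auto
    qed
    moreover have "\<bar>(\<Phi> y - \<Phi> x) * (e y - e x)\<bar> \<le> (M * (y - x)) * (L * (y - x))"
      unfolding abs_mult using xy M L \<Phi>b[of y] eb[of y] by (intro mult_mono) auto
    ultimately have "\<bar>D y - D x\<bar> \<le> (2 * M * L * (y - x)) * (y - x) + (M * (y - x)) * (L * (y - x))"
      by linarith
    then show ?thesis by (simp add: power2_eq_square algebra_simps)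
  qed
  then have "D b = D a"
    using \<open>a \<le> b\<close> by (rule quadratic_increments_imp_constant)
  then have "integral {a..b} K = \<Phi> b * e b"
    by (simp add: D_def \<Phi>_def)
  moreover have "integral {a..b} K = integral {a..b} (\<lambda>t. F t * e t) + integral {a..b} (\<lambda>t. \<Phi> t * e' t)"
    unfolding K_def using iFe i\<Phi>e by (rule integral_add)
  ultimately show ?thesis by (simp add: \<Phi>_def)
qed

section \<open>The du Bois-Reymond lemma, integrated once\<close>

definition weak_derivative :: "real \<Rightarrow> real \<Rightarrow> (real \<Rightarrow> real) \<Rightarrow> (real \<Rightarrow> real) \<Rightarrow> bool" where
  "weak_derivative a b G F \<longleftrightarrow>
     (\<forall>e e'. (\<forall>t\<in>{a..b}. (e has_real_derivative e' t) (at t within {a..b})) \<and>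
        continuous_on {a..b} e' \<and> e a = 0 \<and> e b = 0 \<longrightarrow>
        integral {a..b} (\<lambda>t. F t * e t + G t * e' t) = 0)"

text \<open>The test function is the solution \<open>e\<close> of \<open>e'' = W\<close> with zero boundary values, where \<open>W\<close> is the
  primitive of \<open>G - \<Phi> - c\<close>; two integrations by parts turn the hypothesis into \<open>\<integral> W\<^sup>2 = 0\<close>.\<close>

lemma du_Bois_Reymond_integrated:
  fixes F G :: "real \<Rightarrow> real"
  assumes "a < b"
    and F: "F integrable_on {a..b}" "bounded (F ` {a..b})"
    and G: "G integrable_on {a..b}" "bounded (G ` {a..b})"
    and weak: "weak_derivative a b G F"
  shows "\<exists>c. \<forall>t\<in>{a..b}. integral {a..t} G = integral {a..t} (\<lambda>s. c + integral {a..s} F)"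
proof -
  define \<Phi> where "\<Phi> t = integral {a..t} F" for t
  have c\<Phi>: "continuous_on {a..b} \<Phi>"
    unfolding \<Phi>_def using F(1) by (rule indefinite_integral_continuous_1)
  then have i\<Phi>: "\<Phi> integrable_on {a..b}" and b\<Phi>: "bounded (\<Phi> ` {a..b})"
    by (auto intro: integrable_continuous_real compact_imp_bounded compact_continuous_image)
  \<comment> \<open>The mean of \<open>G - \<Phi>\<close>; this choice makes \<open>W b = 0\<close> below.\<close>
  define c where "c = (integral {a..b} G - integral {a..b} \<Phi>) / (b - a)"
  define w where "w t = G t - (c + \<Phi> t)" for t
  have ic\<Phi>: "(\<lambda>t. c + \<Phi> t) integrable_on {a..b}"
    using i\<Phi> by (intro integrable_add) auto
  have iw: "w integrable_on {a..b}"
    unfolding w_def using G(1) ic\<Phi> by (rule integrable_diff)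
  have bw: "bounded (w ` {a..b})"
    using bounded_minus_comp[OF G(2) bounded_plus_comp[OF _ b\<Phi>], of "\<lambda>_. c"] unfolding w_def
    by (simp add: image_constant_conv)
  define W where "W t = integral {a..t} w" for t
  have cW: "continuous_on {a..b} W"
    unfolding W_def using iw by (rule indefinite_integral_continuous_1)
  have W: "W t = integral {a..t} G - integral {a..t} (\<lambda>s. c + \<Phi> s)" if "t \<in> {a..b}" for t
    unfolding W_def w_def
    using that by (intro integral_diff integrable_subinterval_real[OF G(1)]
        integrable_subinterval_real[OF ic\<Phi>]) auto
  have "integral {a..b} (\<lambda>s. c + \<Phi> s) = c * (b - a) + integral {a..b} \<Phi>"
    using i\<Phi> \<open>a < b\<close> by (subst integral_add) auto
  also have "\<dots> = integral {a..b} G" using \<open>a < b\<close> by (simp add: c_def)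
  finally have Wb: "W b = 0" using W[of b] \<open>a < b\<close> by simp
  define P where "P t = integral {a..t} W" for t
  have dP: "(P has_real_derivative W t) (at t within {a..b})" if "t \<in> {a..b}" for t
    unfolding P_def using cW that by (rule integral_has_real_derivative)
  then have cP: "continuous_on {a..b} P" by (rule DERIV_continuous_on)
  then have iP: "P integrable_on {a..b}" by (rule integrable_continuous_real)
  \<comment> \<open>Subtracting the mean of \<open>P\<close> makes \<open>e b = 0\<close>.\<close>
  define e' where "e' t = P t - integral {a..b} P / (b - a)" for t
  define e where "e t = integral {a..t} e'" for t
  have ce': "continuous_on {a..b} e'"
    unfolding e'_def using cP by (intro continuous_intros)
  have de: "(e has_real_derivative e' t) (at t within {a..b})" if "t \<in> {a..b}" for t
    unfolding e_def using ce' that by (rule integral_has_real_derivative)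
  have de': "(e' has_real_derivative W t) (at t within {a..b})" if "t \<in> {a..b}" for t
    unfolding e'_def using dP[OF that] by (auto intro!: derivative_eq_intros)
  have ea: "e a = 0" by (simp add: e_def)
  have eb: "e b = 0"
    unfolding e_def e'_def using iP \<open>a < b\<close> by (subst integral_diff) auto
  have ce: "continuous_on {a..b} e" using de by (rule DERIV_continuous_on)
  have iFe: "(\<lambda>t. F t * e t) integrable_on {a..b}"
    by (rule bounded_integrable_mult_continuous[OF F ce])
  have iGe: "(\<lambda>t. G t * e' t) integrable_on {a..b}"
    by (rule bounded_integrable_mult_continuous[OF G ce'])
  have iwe: "(\<lambda>t. w t * e' t) integrable_on {a..b}"
    by (rule bounded_integrable_mult_continuous[OF iw bw ce'])
  have i\<Phi>e: "(\<lambda>t. \<Phi> t * e' t) integrable_on {a..b}"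
    by (rule bounded_integrable_mult_continuous[OF i\<Phi> b\<Phi> ce'])
  have ie': "e' integrable_on {a..b}" using ce' by (rule integrable_continuous_real)
  have "0 = integral {a..b} (\<lambda>t. F t * e t + G t * e' t)"
    using weak de ce' ea eb unfolding weak_derivative_def by simp
  also have "\<dots> = integral {a..b} (\<lambda>t. F t * e t) + integral {a..b} (\<lambda>t. G t * e' t)"
    using iFe iGe by (rule integral_add)
  also have "integral {a..b} (\<lambda>t. F t * e t) = - integral {a..b} (\<lambda>t. \<Phi> t * e' t)"
    using integration_by_parts_bounded_integrable[OF F _ de ce'] \<open>a < b\<close> eb by (simp add: \<Phi>_def)
  \<comment> \<open>The terms with \<open>\<Phi> e'\<close> cancel, and \<open>c \<integral> e' = c * e b = 0\<close>.\<close>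
  also have "(\<lambda>t. G t * e' t) = (\<lambda>t. w t * e' t + c * e' t + \<Phi> t * e' t)"
    by (auto simp: w_def algebra_simps)
  also have "integral {a..b} \<dots> = integral {a..b} (\<lambda>t. w t * e' t) + c * e b + integral {a..b} (\<lambda>t. \<Phi> t * e' t)"
    using iwe i\<Phi>e integrable_on_cmult_left[OF ie', of c]
    by (simp add: integral_add integrable_add e_def)
  \<comment> \<open>The boundary term \<open>W b * e' b\<close> vanishes because \<open>W b = 0\<close>.\<close>
  also have "integral {a..b} (\<lambda>t. w t * e' t) = - integral {a..b} (\<lambda>t. W t * W t)"
    using integration_by_parts_bounded_integrable[OF iw bw _ de' cW] \<open>a < b\<close> Wb by (simp add: W_def)
  finally have "integral {a..b} (\<lambda>t. W t * W t) = 0" using eb by simp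
  then have "W t = 0" if "t \<in> {a..b}" for t
    using integral_eq_0_iff[OF continuous_on_mult[OF cW cW] \<open>a < b\<close>] that by simp
  then have "integral {a..t} G = integral {a..t} (\<lambda>s. c + integral {a..s} F)" if "t \<in> {a..b}" for t
    using W[OF that] that by (simp add: \<Phi>_def)
  then show ?thesis by blast
qed

section \<open>Almost everywhere differentiability of indefinite integrals\<close>

lemma right_derivative_of_integral_ae:
  fixes F :: "real \<Rightarrow> real"
  assumes F: "\<And>x y. F integrable_on {x..y}"
  obtains N where "negligible N" "\<And>x \<epsilon>. x \<notin> N \<Longrightarrow> 0 < \<epsilon> \<Longrightarrow>
      \<exists>d>0. \<forall>h. 0 < h \<and> h < d \<longrightarrow> \<bar>integral {x..x + h} F / h - F x\<bar> < \<epsilon>"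
proof -
  have "F integrable_on cbox x y" for x y
    using F by simp
  then obtain N where "negligible N" and N: "\<And>x \<epsilon>. \<lbrakk>x \<notin> N; 0 < \<epsilon>\<rbrakk> \<Longrightarrow>
      \<exists>d>0. \<forall>h. 0 < h \<and> h < d \<longrightarrow>
        norm (integral (cbox x (x + h *\<^sub>R One)) F /\<^sub>R h ^ DIM(real) - F x) < \<epsilon>"
    by (rule integrable_ccontinuous_explicit) (rule that)
  show ?thesis
  proof
    fix x \<epsilon> :: real
    assume "x \<notin> N" "0 < \<epsilon>"
    then show "\<exists>d>0. \<forall>h. 0 < h \<and> h < d \<longrightarrow> \<bar>integral {x..x + h} F / h - F x\<bar> < \<epsilon>"
      using N[of x \<epsilon>] by (simp add: divide_inverse mult.commute)
  qed fact
qed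

text \<open>Left difference quotients of the integral of \<open>F\<close> at \<open>t\<close> are right difference quotients
  at \<open>- t\<close> for the reflected function, so the one-sided theorem, applied to both functions, gives the
  two-sided derivative off a null set.\<close>

lemma integral_has_real_derivative_ae:
  fixes F :: "real \<Rightarrow> real"
  assumes F: "F integrable_on {a..b}"
  shows "\<exists>N. negligible N \<and>
    (\<forall>t\<in>{a..b} - N. ((\<lambda>u. integral {a..u} F) has_real_derivative F t) (at t within {a..b}))"
proof -
  \<comment> \<open>Extended by zero, \<open>F\<close> is integrable on every interval, as the one-sided theorem requires.\<close>
  define F0 where "F0 t = (if t \<in> {a..b} then F t else 0)" for t
  have F0: "F0 integrable_on {x..y}" for x y
  proof -
    have "F0 integrable_on UNIV"
      unfolding F0_def using F by (subst integrable_restrict_UNIV)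
    then show ?thesis by (metis box_real(2) integrable_on_subcbox subset_UNIV)
  qed
  obtain N1 where N1: "negligible N1" and right: "\<And>x \<epsilon>. x \<notin> N1 \<Longrightarrow> 0 < \<epsilon> \<Longrightarrow>
      \<exists>d>0. \<forall>h. 0 < h \<and> h < d \<longrightarrow> \<bar>integral {x..x + h} F0 / h - F0 x\<bar> < \<epsilon>"
    by (rule right_derivative_of_integral_ae[OF F0]) (rule that)
  have F0m: "(\<lambda>x. F0 (- x)) integrable_on {x..y}" for x y
    using F0[of "- y" "- x"] Henstock_Kurzweil_Integration.integrable_reflect_real[of F0 "- x" "- y"] by simp
  obtain N2 where N2: "negligible N2" and left: "\<And>x \<epsilon>. x \<notin> N2 \<Longrightarrow> 0 < \<epsilon> \<Longrightarrow>
      \<exists>d>0. \<forall>h. 0 < h \<and> h < d \<longrightarrow> \<bar>integral {x..x + h} (\<lambda>x. F0 (- x)) / h - F0 (- x)\<bar> < \<epsilon>"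
    by (rule right_derivative_of_integral_ae[OF F0m]) (rule that)
  define N where "N = N1 \<union> uminus ` N2"
  have "negligible (uminus ` N2)"
    using N2 by (intro negligible_differentiable_image_negligible) (auto intro: derivative_intros)
  with N1 have "negligible N" by (simp add: N_def)
  moreover have "((\<lambda>u. integral {a..u} F) has_real_derivative F t) (at t within {a..b})"
    if t: "t \<in> {a..b} - N" for t
    unfolding has_field_derivative_iff
  proof (rule tendstoI)
    fix \<epsilon> :: real assume "\<epsilon> > 0"
    have "t \<notin> N1" "- t \<notin> N2" using t by (auto simp: N_def image_iff)
    from right[OF this(1) \<open>\<epsilon> > 0\<close>] obtain d1 where d1: "d1 > 0"
      "\<And>h. 0 < h \<Longrightarrow> h < d1 \<Longrightarrow> \<bar>integral {t..t + h} F0 / h - F0 t\<bar> < \<epsilon>" by blast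
    from left[OF \<open>- t \<notin> N2\<close> \<open>\<epsilon> > 0\<close>] obtain d2 where d2: "d2 > 0"
      "\<And>h. 0 < h \<Longrightarrow> h < d2 \<Longrightarrow> \<bar>integral {- t..- t + h} (\<lambda>x. F0 (- x)) / h - F0 t\<bar> < \<epsilon>" by auto
    have FF0: "integral {x..y} F0 = integral {a..y} F - integral {a..x} F"
      if "a \<le> x" "x \<le> y" "y \<le> b" for x y
    proof -
      have "integral {x..y} F0 = integral {x..y} F"
        using that by (intro integral_cong) (auto simp: F0_def)
      also have "\<dots> = integral {a..y} F - integral {a..x} F"
        using Henstock_Kurzweil_Integration.integral_combine[of a x y F] integrable_subinterval_real[OF F, of a y] that by auto
      finally show ?thesis .
    qed
    have "dist ((integral {a..y} F - integral {a..t} F) / (y - t)) (F t) < \<epsilon>"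
      if y: "y \<in> {a..b}" "y \<noteq> t" "dist y t < min d1 d2" for y
    proof (cases "t < y")
      case True
      then show ?thesis
        using d1(2)[of "y - t"] y t FF0[of t y] by (simp add: dist_real_def F0_def)
    next
      case False
      have "integral {- t..- y} (\<lambda>x. F0 (- x)) = integral {a..t} F - integral {a..y} F"
        using False y t FF0[of y t] by simp
      moreover have "(integral {a..t} F - integral {a..y} F) / (t - y) = (integral {a..y} F - integral {a..t} F) / (y - t)"
        by (metis minus_diff_eq minus_divide_divide)
      ultimately show ?thesis
        using d2(2)[of "t - y"] False y t by (simp add: dist_real_def F0_def)
    qed
    then show "\<forall>\<^sub>F y in at t within {a..b}.
        dist ((integral {a..y} F - integral {a..t} F) / (y - t)) (F t) < \<epsilon>"
      using d1(1) d2(1) by (auto simp: eventually_at intro!: exI[of _ "min d1 d2"])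
  qed
  ultimately show ?thesis by blast
qed

lemma indefinite_integral_cong_imp_ae_eq:
  fixes F G :: "real \<Rightarrow> real"
  assumes "a < b" and F: "F integrable_on {a..b}" and G: "G integrable_on {a..b}"
    and eq: "\<forall>t\<in>{a..b}. integral {a..t} F = integral {a..t} G"
  shows "\<exists>N. negligible N \<and> (\<forall>t\<in>{a..b} - N. F t = G t)"
proof -
  obtain N where N: "negligible N"
    "\<forall>t\<in>{a..b} - N. ((\<lambda>u. integral {a..u} F) has_real_derivative F t) (at t within {a..b})"
    using integral_has_real_derivative_ae[OF F] by blast
  obtain N' where N': "negligible N'"
    "\<forall>t\<in>{a..b} - N'. ((\<lambda>u. integral {a..u} G) has_real_derivative G t) (at t within {a..b})"
    using integral_has_real_derivative_ae[OF G] by blast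
  have "F t = G t" if t: "t \<in> {a..b} - (N \<union> N')" for t
  proof (rule has_field_derivative_unique)
    show "((\<lambda>u. integral {a..u} F) has_real_derivative F t) (at t within {a..b})"
      using N(2) t by blast
    have "((\<lambda>u. integral {a..u} G) has_real_derivative G t) (at t within {a..b})"
      using N'(2) t by blast
    then show "((\<lambda>u. integral {a..u} F) has_real_derivative G t) (at t within {a..b})"
      by (rule has_field_derivative_transform_within[where d = 1]) (use t eq in auto)
    show "at t within {a..b} \<noteq> bot"
      using t \<open>a < b\<close> by (simp add: trivial_limit_within islimpt_Icc)
  qed
  then show ?thesis
    using negligible_Un[OF N(1) N'(1)] by blast
qed

section \<open>The du Bois-Reymond lemma for real functions\<close>

lemma du_Bois_Reymond_ae:
  fixes F G :: "real \<Rightarrow> real"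
  assumes "a < b"
    and F: "F integrable_on {a..b}" "bounded (F ` {a..b})"
    and G: "G integrable_on {a..b}" "bounded (G ` {a..b})"
    and weak: "weak_derivative a b G F"
  shows "\<exists>H N. negligible N \<and> continuous_on {a..b} H \<and>
    (\<forall>t\<in>{a..b} - N. G t = H t \<and> (H has_real_derivative F t) (at t within {a..b}))"
proof -
  obtain c where c: "\<forall>t\<in>{a..b}. integral {a..t} G = integral {a..t} (\<lambda>s. c + integral {a..s} F)"
    using du_Bois_Reymond_integrated[OF assms] ..
  define H where "H t = c + integral {a..t} F" for t
  have cH: "continuous_on {a..b} H"
    unfolding H_def using indefinite_integral_continuous_1[OF F(1)] by (intro continuous_intros)
  have "\<forall>t\<in>{a..b}. integral {a..t} G = integral {a..t} H"
    using c by (simp add: H_def[abs_def])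
  then obtain N where N: "negligible N" "\<forall>t\<in>{a..b} - N. G t = H t"
    using indefinite_integral_cong_imp_ae_eq[OF \<open>a < b\<close> G(1) integrable_continuous_real[OF cH]] by blast
  obtain N' where N': "negligible N'"
    "\<forall>t\<in>{a..b} - N'. ((\<lambda>u. integral {a..u} F) has_real_derivative F t) (at t within {a..b})"
    using integral_has_real_derivative_ae[OF F(1)] by blast
  have "G t = H t \<and> (H has_real_derivative F t) (at t within {a..b})"
    if "t \<in> {a..b} - (N \<union> N')" for t
    unfolding H_def[abs_def] using that N(2) N'(2)
    by (auto simp: H_def intro!: derivative_eq_intros)
  then show ?thesis
    using negligible_Un[OF N(1) N'(1)] cH by blast
qed

text \<open>A continuous function is determined at every point by its indefinite integral, so no null set
  has to be excepted.\<close>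

lemma du_Bois_Reymond_continuous:
  fixes F G :: "real \<Rightarrow> real"
  assumes "a < b"
    and F: "continuous_on {a..b} F" and G: "continuous_on {a..b} G"
    and weak: "weak_derivative a b G F"
    and t: "t \<in> {a..b}"
  shows "(G has_real_derivative F t) (at t within {a..b})"
proof -
  have bdd: "bounded (X ` {a..b})" if "continuous_on {a..b} X" for X :: "real \<Rightarrow> real"
    using that by (intro compact_imp_bounded compact_continuous_image) auto
  note int = integrable_continuous_real[OF F] bdd[OF F] integrable_continuous_real[OF G] bdd[OF G]
  obtain c where c: "\<forall>t\<in>{a..b}. integral {a..t} G = integral {a..t} (\<lambda>s. c + integral {a..s} F)"
    using du_Bois_Reymond_integrated[OF \<open>a < b\<close> int weak] ..
  define H where "H t = c + integral {a..t} F" for t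
  have dH: "(H has_real_derivative F t) (at t within {a..b})" if "t \<in> {a..b}" for t
    unfolding H_def[abs_def] using integral_has_real_derivative[OF F that]
    by (auto intro!: derivative_eq_intros)
  then have cH: "continuous_on {a..b} H" by (rule DERIV_continuous_on)
  have "G s = H s" if s: "s \<in> {a..b}" for s
  proof (rule has_field_derivative_unique)
    show "((\<lambda>u. integral {a..u} G) has_real_derivative G s) (at s within {a..b})"
      using G s by (rule integral_has_real_derivative)
    show "((\<lambda>u. integral {a..u} G) has_real_derivative H s) (at s within {a..b})"
      using integral_has_real_derivative[OF cH s]
      by (rule has_field_derivative_transform_within[where d = 1]) (use s c in \<open>auto simp: H_def[abs_def]\<close>)
    show "at s within {a..b} \<noteq> bot"
      using s \<open>a < b\<close> by (simp add: trivial_limit_within islimpt_Icc)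
  qed
  then show ?thesis
    by (intro has_field_derivative_transform_within[OF dH[OF t], where d = 1]) (use t in auto)
qed

section \<open>Coordinates of fuzzy-valued functions\<close>

lemma abs_rco_le_fnorm: "\<bar>rco A B\<bar> \<le> (1 + \<bar>core A\<bar>) * fnorm A B"
proof -
  have "\<bar>rco A B\<bar> \<le> \<bar>rco A B + qco A B * core A\<bar> + \<bar>qco A B\<bar> * \<bar>core A\<bar>"
    using abs_triangle_ineq4[of "rco A B + qco A B * core A" "qco A B * core A"]
    by (simp add: abs_mult)
  also have "\<dots> \<le> (1 + \<bar>core A\<bar>) * fnorm A B"
    by (simp add: fnorm_def algebra_simps)
  finally show ?thesis .
qed

lemma abs_qco_le_fnorm: "\<bar>qco A B\<bar> \<le> fnorm A B"
  by (simp add: fnorm_def)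

lemma fnorm_tendsto_zero_iff:
  "((\<lambda>s. fnorm A (B s)) \<longlongrightarrow> 0) \<F> \<longleftrightarrow>
     ((\<lambda>s. rco A (B s)) \<longlongrightarrow> 0) \<F> \<and> ((\<lambda>s. qco A (B s)) \<longlongrightarrow> 0) \<F>"
proof
  assume lim: "((\<lambda>s. fnorm A (B s)) \<longlongrightarrow> 0) \<F>"
  then have "((\<lambda>s. (1 + \<bar>core A\<bar>) * fnorm A (B s)) \<longlongrightarrow> 0) \<F>"
    by (rule tendsto_mult_right_zero)
  with lim show "((\<lambda>s. rco A (B s)) \<longlongrightarrow> 0) \<F> \<and> ((\<lambda>s. qco A (B s)) \<longlongrightarrow> 0) \<F>"
    using abs_rco_le_fnorm abs_qco_le_fnorm
    by (auto intro!: always_eventually elim: Lim_null_comparison[rotated])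
next
  assume "((\<lambda>s. rco A (B s)) \<longlongrightarrow> 0) \<F> \<and> ((\<lambda>s. qco A (B s)) \<longlongrightarrow> 0) \<F>"
  then show "((\<lambda>s. fnorm A (B s)) \<longlongrightarrow> 0) \<F>"
    unfolding fnorm_def by (auto intro!: tendsto_eq_intros)
qed

text \<open>For smooth \<open>g\<close> and \<open>f = g'\<close> this is the Leibniz rule \<open>(g \<odot> \<eta>)' = g' \<odot> \<eta> \<oplus> g \<odot> \<eta>'\<close>,
  integrated over \<open>[a, b]\<close>.\<close>

definition fweak_derivative ::
  "(real \<Rightarrow> real) \<Rightarrow> real \<Rightarrow> real \<Rightarrow> (real \<Rightarrow> real \<Rightarrow> real) \<Rightarrow> (real \<Rightarrow> real \<Rightarrow> real) \<Rightarrow> bool" where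
  "fweak_derivative A a b g f \<longleftrightarrow>
     (\<forall>\<eta> \<eta>'. fC1 A a b \<eta> \<eta>' \<and> \<eta> a = fzero A \<and> \<eta> b = fzero A \<longrightarrow>
        has_fint A a b (\<lambda>t. f t \<odot>\<^bsub>A\<^esub> \<eta> t \<oplus>\<^bsub>A\<^esub> g t \<odot>\<^bsub>A\<^esub> \<eta>' t) (fzero A))"

context
  fixes A :: "real \<Rightarrow> real" and a_m :: real
  assumes A: "fuzzy_number A" "asymmetric A" "level A 1 = {a_m}"
begin

lemmas [simp] = rco_affine_fuzzy[OF A] qco_affine_fuzzy[OF A]

lemma affine_fuzzy_in_RF [simp]: "affine_fuzzy A r q \<in> RF A"
  by (auto simp: RF_def)

lemma affine_fuzzy_coords: "B \<in> RF A \<Longrightarrow> affine_fuzzy A (rco A B) (qco A B) = B"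
  by (auto simp: RF_def)

lemma fdiff_eq: "B \<ominus>\<^bsub>A\<^esub> C = affine_fuzzy A (rco A B - rco A C) (qco A B - qco A C)"
  by (simp add: fdiff_def fadd_def fscale_def)

lemma fcontinuous_on_iff:
  "fcontinuous_on A S f \<longleftrightarrow>
     continuous_on S (\<lambda>t. rco A (f t)) \<and> continuous_on S (\<lambda>t. qco A (f t))"
  unfolding fcontinuous_on_def fnorm_tendsto_zero_iff continuous_on_def
  by (auto simp: fdiff_eq LIM_zero_iff)

lemma has_fderiv_iff:
  "has_fderiv A S f t D \<longleftrightarrow> D \<in> RF A \<and>
     ((\<lambda>s. rco A (f s)) has_real_derivative rco A D) (at t within S) \<and>
     ((\<lambda>s. qco A (f s)) has_real_derivative qco A D) (at t within S)"
  unfolding has_fderiv_def fnorm_tendsto_zero_iff has_field_derivative_iff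
  by (simp add: fdiff_eq fscale_def LIM_zero_iff)

text \<open>Each coordinate is bounded by a multiple of the norm, so it inherits the convergence of the
  Riemann sums.\<close>

lemma has_fint_imp_has_riemann_integral:
  assumes "has_fint A a b f J"
  shows "has_riemann_integral (\<lambda>t. rco A (f t)) (rco A J) a b"
    and "has_riemann_integral (\<lambda>t. qco A (f t)) (qco A J) a b"
proof -
  let ?E = "\<lambda>p. fsum A (\<lambda>(x, K). fscale A (measure lborel K) (f x)) p \<ominus>\<^bsub>A\<^esub> J"
  have E: "rco A (?E p) = (\<Sum>(x, K)\<in>p. measure lborel K * rco A (f x)) - rco A J"
    "qco A (?E p) = (\<Sum>(x, K)\<in>p. measure lborel K * qco A (f x)) - qco A J" for p
    by (auto simp: fdiff_eq fsum_def fscale_def intro!: sum.cong)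
  have conv: "\<exists>d>0. \<forall>p. p tagged_division_of {a..b} \<and> (\<lambda>x. ball x d) fine p \<longrightarrow> \<bar>c (?E p)\<bar> < \<epsilon>"
    if c: "\<And>B. \<bar>c B\<bar> \<le> k * fnorm A B" and "k > 0" "\<epsilon> > 0" for c :: "(real \<Rightarrow> real) \<Rightarrow> real" and k \<epsilon>
  proof -
    have "\<epsilon> / k > 0" using that by simp
    then obtain d where "d > 0" and d: "\<And>p. p tagged_division_of {a..b} \<Longrightarrow>
        (\<lambda>x. ball x d) fine p \<Longrightarrow> fnorm A (?E p) < \<epsilon> / k"
      using assms unfolding has_fint_def by blast
    have "\<bar>c (?E p)\<bar> < \<epsilon>" if "p tagged_division_of {a..b}" "(\<lambda>x. ball x d) fine p" for p
    proof -
      have "k * fnorm A (?E p) < \<epsilon>" using d[OF that] \<open>k > 0\<close> by (simp add: field_simps)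
      then show ?thesis using c[of "?E p"] by linarith
    qed
    with \<open>d > 0\<close> show ?thesis by blast
  qed
  show "has_riemann_integral (\<lambda>t. rco A (f t)) (rco A J) a b"
    unfolding has_riemann_integral_def E(1)[symmetric]
    using conv[OF abs_rco_le_fnorm] by (simp add: add_pos_nonneg)
  show "has_riemann_integral (\<lambda>t. qco A (f t)) (qco A J) a b"
    unfolding has_riemann_integral_def E(2)[symmetric]
    using conv[of "qco A" 1] abs_qco_le_fnorm by simp
qed

lemma fintegrable_components:
  assumes "fintegrable A a b f" "a < b"
  shows "(\<lambda>t. rco A (f t)) integrable_on {a..b}" "bounded ((\<lambda>t. rco A (f t)) ` {a..b})"
    and "(\<lambda>t. qco A (f t)) integrable_on {a..b}" "bounded ((\<lambda>t. qco A (f t)) ` {a..b})"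
proof -
  obtain J where "has_fint A a b f J" using assms(1) by (auto simp: fintegrable_def)
  note R = has_fint_imp_has_riemann_integral[OF this]
  show "(\<lambda>t. rco A (f t)) integrable_on {a..b}" "(\<lambda>t. qco A (f t)) integrable_on {a..b}"
    using R[THEN has_riemann_integral_imp_has_integral] by (auto intro: has_integral_integrable)
  show "bounded ((\<lambda>t. rco A (f t)) ` {a..b})" "bounded ((\<lambda>t. qco A (f t)) ` {a..b})"
    using R[THEN has_riemann_integral_imp_bounded] \<open>a < b\<close> by auto
qed

lemma cross_crisp:
  assumes "B \<in> RF A"
  shows "B \<odot>\<^bsub>A\<^esub> affine_fuzzy A c 0 = affine_fuzzy A (rco A B * c) (qco A B * c)"
  using cross_affine_fuzzy[OF A, of "rco A B" "qco A B" c 0]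
  by (simp add: affine_fuzzy_coords assms mult.commute)

section \<open>The du Bois-Reymond lemma for fuzzy-valued functions\<close>

text \<open>Test functions \<open>e + 0A\<close> multiply both coordinates by \<open>e\<close>, so the two coordinates of the
  integral separate.\<close>

lemma fweak_derivative_components:
  assumes weak: "fweak_derivative A a b g f" and f: "f \<in> {a..b} \<rightarrow> RF A" and g: "g \<in> {a..b} \<rightarrow> RF A"
  shows "weak_derivative a b (\<lambda>t. rco A (g t)) (\<lambda>t. rco A (f t))"
    and "weak_derivative a b (\<lambda>t. qco A (g t)) (\<lambda>t. qco A (f t))"
proof -
  have "integral {a..b} (\<lambda>t. rco A (f t) * e t + rco A (g t) * e' t) = 0 \<and>
      integral {a..b} (\<lambda>t. qco A (f t) * e t + qco A (g t) * e' t) = 0"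
    if e: "\<forall>t\<in>{a..b}. (e has_real_derivative e' t) (at t within {a..b})"
      and e': "continuous_on {a..b} e'" and e0: "e a = 0" "e b = 0" for e e'
  proof -
    define \<eta> \<eta>' where "\<eta> t = affine_fuzzy A (e t) 0" and "\<eta>' t = affine_fuzzy A (e' t) 0" for t
    have "fC1 A a b \<eta> \<eta>'"
      using e e' by (auto simp: fC1_def fcontinuous_on_iff has_fderiv_iff \<eta>_def \<eta>'_def)
    moreover have "\<eta> a = fzero A" "\<eta> b = fzero A"
      by (simp_all add: \<eta>_def fzero_def e0)
    ultimately have "has_fint A a b (\<lambda>t. f t \<odot>\<^bsub>A\<^esub> \<eta> t \<oplus>\<^bsub>A\<^esub> g t \<odot>\<^bsub>A\<^esub> \<eta>' t) (fzero A)" (is "has_fint A a b ?I _")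
      using weak by (auto simp: fweak_derivative_def)
    note I = has_fint_imp_has_riemann_integral[OF this, THEN has_riemann_integral_imp_has_integral]
    have "rco A (?I t) = rco A (f t) * e t + rco A (g t) * e' t"
      "qco A (?I t) = qco A (f t) * e t + qco A (g t) * e' t" if "t \<in> {a..b}" for t
    proof -
      have "f t \<in> RF A" "g t \<in> RF A" using f g that by blast+
      then show "rco A (?I t) = rco A (f t) * e t + rco A (g t) * e' t"
        "qco A (?I t) = qco A (f t) * e t + qco A (g t) * e' t"
        by (simp_all add: \<eta>_def \<eta>'_def cross_crisp fadd_def)
    qed
    then have "((\<lambda>t. rco A (f t) * e t + rco A (g t) * e' t) has_integral 0) {a..b}"
      "((\<lambda>t. qco A (f t) * e t + qco A (g t) * e' t) has_integral 0) {a..b}"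
      using has_integral_eq[OF _ I(1)] has_integral_eq[OF _ I(2)] by (simp_all add: fzero_def)
    then show ?thesis by (simp add: integral_unique)
  qed
  then show "weak_derivative a b (\<lambda>t. rco A (g t)) (\<lambda>t. rco A (f t))"
    and "weak_derivative a b (\<lambda>t. qco A (g t)) (\<lambda>t. qco A (f t))"
    unfolding weak_derivative_def by blast+
qed

lemma fweak_derivative_imp_ae_derivative:
  assumes "a < b" and f: "f \<in> {a..b} \<rightarrow> RF A" and g: "g \<in> {a..b} \<rightarrow> RF A"
    and int: "fintegrable A a b f" "fintegrable A a b g"
    and weak: "fweak_derivative A a b g f"
  shows "\<exists>h. h \<in> {a..b} \<rightarrow> RF A \<and> fcontinuous_on A {a..b} h \<and>
    (AE t\<in>{a..b} in lebesgue. h t \<ominus>\<^bsub>A\<^esub> g t \<in> RF0 A \<and> has_fderiv A {a..b} h t (f t))"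
proof -
  note fc = fintegrable_components[OF int(1) \<open>a < b\<close>]
  note gc = fintegrable_components[OF int(2) \<open>a < b\<close>]
  note w = fweak_derivative_components[OF weak f g]
  obtain r N where "negligible N" and r: "continuous_on {a..b} r"
    "\<forall>t\<in>{a..b} - N. rco A (g t) = r t \<and> (r has_real_derivative rco A (f t)) (at t within {a..b})"
    using du_Bois_Reymond_ae[OF \<open>a < b\<close> fc(1,2) gc(1,2) w(1)] by blast
  moreover obtain q N' where "negligible N'" and q: "continuous_on {a..b} q"
    "\<forall>t\<in>{a..b} - N'. qco A (g t) = q t \<and> (q has_real_derivative qco A (f t)) (at t within {a..b})"
    using du_Bois_Reymond_ae[OF \<open>a < b\<close> fc(3,4) gc(3,4) w(2)] by blast
  ultimately have N: "N \<union> N' \<in> null_sets lebesgue"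
    by (simp add: negligible_Un flip: negligible_iff_null_sets)
  define h where "h t = affine_fuzzy A (r t) (q t)" for t
  have "h t \<ominus>\<^bsub>A\<^esub> g t \<in> RF0 A \<and> has_fderiv A {a..b} h t (f t)" if "t \<in> {a..b}" "t \<notin> N \<union> N'" for t
    using that r(2) q(2) f
    by (auto simp: h_def fdiff_eq affine_fuzzy_in_RF0_iff[OF A] has_fderiv_iff)
  then have "AE t\<in>{a..b} in lebesgue. h t \<ominus>\<^bsub>A\<^esub> g t \<in> RF0 A \<and> has_fderiv A {a..b} h t (f t)"
    by (intro eventually_mono[OF AE_not_in[OF N]]) blast
  then show ?thesis
    using r(1) q(1) by (intro exI[of _ h]) (auto simp: h_def fcontinuous_on_iff)
qed

lemma continuous_fweak_derivative_imp_derivative: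
  assumes "a < b" and f: "f \<in> {a..b} \<rightarrow> RF A" and g: "g \<in> {a..b} \<rightarrow> RF A"
    and cont: "fcontinuous_on A {a..b} f" "fcontinuous_on A {a..b} g"
    and weak: "fweak_derivative A a b g f" and t: "t \<in> {a..b}"
  shows "has_fderiv A {a..b} g t (f t)"
proof -
  note w = fweak_derivative_components[OF weak f g]
  have "((\<lambda>s. rco A (g s)) has_real_derivative rco A (f t)) (at t within {a..b})"
    "((\<lambda>s. qco A (g s)) has_real_derivative qco A (f t)) (at t within {a..b})"
    using cont du_Bois_Reymond_continuous[OF \<open>a < b\<close> _ _ w(1) t]
      du_Bois_Reymond_continuous[OF \<open>a < b\<close> _ _ w(2) t]
    by (auto simp: fcontinuous_on_iff)
  then show ?thesis using f t by (auto simp: has_fderiv_iff)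
qed

end

theorem theorem6:
  fixes A :: "real \<Rightarrow> real" and a_m a b :: real and f g :: "real \<Rightarrow> real \<Rightarrow> real"
  assumes "fuzzy_number A" and "asymmetric A" and "level A 1 = {a_m}" and "a < b"
    and "f \<in> {a..b} \<rightarrow> RF A" and "g \<in> {a..b} \<rightarrow> RF A"
  shows "(fintegrable A a b f \<and> fintegrable A a b g \<and>
          (\<forall>\<eta> \<eta>'. fC1 A a b \<eta> \<eta>' \<and> \<eta> a = fzero A \<and> \<eta> b = fzero A \<longrightarrow>
             has_fint A a b (\<lambda>t. f t \<odot>\<^bsub>A\<^esub> \<eta> t \<oplus>\<^bsub>A\<^esub> g t \<odot>\<^bsub>A\<^esub> \<eta>' t) (fzero A)) \<longrightarrow>
          (\<exists>h. h \<in> {a..b} \<rightarrow> RF A \<and> fcontinuous_on A {a..b} h \<and>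
             (AE t\<in>{a..b} in lebesgue.
                h t \<ominus>\<^bsub>A\<^esub> g t \<in> RF0 A \<and> has_fderiv A {a..b} h t (f t))))
       \<and> (fcontinuous_on A {a..b} f \<and> fcontinuous_on A {a..b} g \<and>
          (AE t\<in>{a..b} in lebesgue. fdifferentiable A {a..b} g t) \<and>
          (\<forall>\<eta> \<eta>'. fC1 A a b \<eta> \<eta>' \<and> \<eta> a = fzero A \<and> \<eta> b = fzero A \<longrightarrow>
             has_fint A a b (\<lambda>t. f t \<odot>\<^bsub>A\<^esub> \<eta> t \<oplus>\<^bsub>A\<^esub> g t \<odot>\<^bsub>A\<^esub> \<eta>' t) (fzero A)) \<longrightarrow>
          (AE t\<in>{a..b} in lebesgue. has_fderiv A {a..b} g t (f t)))"
proof (intro conjI impI; elim conjE)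
  assume "fintegrable A a b f" "fintegrable A a b g"
    and "\<forall>\<eta> \<eta>'. fC1 A a b \<eta> \<eta>' \<and> \<eta> a = fzero A \<and> \<eta> b = fzero A \<longrightarrow>
      has_fint A a b (\<lambda>t. f t \<odot>\<^bsub>A\<^esub> \<eta> t \<oplus>\<^bsub>A\<^esub> g t \<odot>\<^bsub>A\<^esub> \<eta>' t) (fzero A)"
  then show "\<exists>h. h \<in> {a..b} \<rightarrow> RF A \<and> fcontinuous_on A {a..b} h \<and>
      (AE t\<in>{a..b} in lebesgue. h t \<ominus>\<^bsub>A\<^esub> g t \<in> RF0 A \<and> has_fderiv A {a..b} h t (f t))"
    by (rule fweak_derivative_imp_ae_derivative[OF assms, unfolded fweak_derivative_def])
next
  assume cont: "fcontinuous_on A {a..b} f" "fcontinuous_on A {a..b} g"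
    and weak: "\<forall>\<eta> \<eta>'. fC1 A a b \<eta> \<eta>' \<and> \<eta> a = fzero A \<and> \<eta> b = fzero A \<longrightarrow>
      has_fint A a b (\<lambda>t. f t \<odot>\<^bsub>A\<^esub> \<eta> t \<oplus>\<^bsub>A\<^esub> g t \<odot>\<^bsub>A\<^esub> \<eta>' t) (fzero A)"
  have "has_fderiv A {a..b} g t (f t)" if "t \<in> {a..b}" for t
    using weak that
    by (intro continuous_fweak_derivative_imp_derivative[OF assms cont]) (simp_all only: fweak_derivative_def)
  then show "AE t\<in>{a..b} in lebesgue. has_fderiv A {a..b} g t (f t)"
    by (intro AE_I2) blast
qed

end
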